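(* Let $\Sigma$ be a finite alphabet with $|\Sigma|\geq 2$, $I\subseteq\Sigma\times\Sigma$ an irreflexive symmetric relation, $\mathcal{M}=\mathcal{M}(\Sigma,I)$ the associated trace monoid, $X$ a finite nonempty set, and $X\times\mathcal{M}\to X$, $(\alpha,x)\mapsto\alpha\cdot x$, a right action of $\mathcal{M}$ on $X$ (so $\alpha\cdot 1=\alpha$ and $(\alpha\cdot x)\cdot y=\alpha\cdot(x\cdot y)$). Let $\mathbb{P}=(\mathbb{P}_\alpha)_{\alpha\in X}$ be a Markov measure for this action, i.e. each $\mathbb{P}_\alpha$ is a probability measure on $\partial\mathcal{M}$ and $\mathbb{P}_\alpha(\uparrow(x\cdot y))=\mathbb{P}_\alpha(\uparrow x)\,\mathbb{P}_{\alpha\cdot x}(\uparrow y)$ for all $\alpha\in X$, $x,y\in\mathcal{M}$. Put $f_\alpha(x)=\mathbb{P}_\alpha(\uparrow x)$ and let $h_\alpha:\mathscr{C}\to\mathbb{R}$ be the Möbius transform of $f_\alpha$ restricted to $\mathscr{C}$. Then: (1) the family $(f_\alpha)_{\alpha\in X}$ is a Möbius fibred valuation, i.e. $h_\alpha(1)=0$ and $h_\alpha(\gamma)\geq 0$ for all $\gamma\in\mathfrak{C}$ and all $\alpha\in X$; (2) fix $\alpha_0\in X$; for $\xi=(c_i)_{i\geq1}\in\partial\mathcal{M}$ let $C_i(\xi)=c_i$, $Y_i=C_1\cdot\ldots\cdot C_i$ ($Y_0=1$) and $X_i=\alpha_0\cdot Y_i$ for $i\geq0$; then under $\mathbb{P}_{\alpha_0}$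 the sequence $(X_{i-1},C_i)_{i\geq1}$ is a homogeneous Markov chain with values in $X\times\mathfrak{C}$; (3) its initial law is $\delta_{\{\alpha_0\}}\otimes(h_{\alpha_0}|_{\mathfrak{C}})$, i.e. $\mathbb{P}_{\alpha_0}(X_0=\alpha,C_1=\gamma)=\mathbf{1}_{\{\alpha=\alpha_0\}}h_{\alpha_0}(\gamma)$ for $(\alpha,\gamma)\in X\times\mathfrak{C}$; (4) its transition matrix does not depend on $\alpha_0$ and is given by $P_{(\alpha,\gamma),(\alpha',\gamma')}=\mathbf{1}_{\{\alpha'=\alpha\cdot\gamma\}}\mathbf{1}_{\{\gamma\to\gamma'\}}\dfrac{h_{\alpha'}(\gamma')}{g_{\alpha'}(\gamma)}$, where $g_{\alpha'}(\gamma)=\sum_{\gamma'\in\mathfrak{C}:\gamma\to\gamma'}h_{\alpha'}(\gamma')\geq 0$, with the convention that $P_{(\alpha,\gamma),(\alpha',\gamma')}=0$ whenever $g_{\alpha'}(\gamma)=0$.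
   Context: $\mathcal{M}(\Sigma,I)$ is the quotient of the free monoid $\Sigma^*$ by the congruence generated by $ab=ba$ for $(a,b)\in I$; its elements are traces, the product is written $\cdot$, the unit $1$, letters are identified with their images, $|x|$ is the length, and $x\leq y$ means $y=x\cdot z$ for some $z\in\mathcal{M}$. A clique is a trace $a_1\cdot\ldots\cdot a_k$ ($k\geq0$) with pairwise distinct letters satisfying $(a_i,a_j)\in I$ for $i\neq j$; $\mathscr{C}$ is the set of cliques (identified with subsets of $\Sigma$; the order $\leq$ on cliques is inclusion) and $\mathfrak{C}=\mathscr{C}\setminus\{1\}$. For cliques $c,c'$, $c\to c'$ means: for every $b\in c'$ there is $a\in c$ with $(a,b)\notin I$. Every nonempty trace $x$ has a unique decomposition $x=c_1\cdot\ldots\cdot c_n$ with $c_i\in\mathfrak{C}$ and $c_i\to c_{i+1}$; $n=\tau(x)$ is its height, $\tau(1)=0$. The boundary $\partial\mathcal{M}$ is the set of infinite sequences $\xi=(c_i)_{i\geq1}$ of nonempty cliques with $c_i\to c_{i+1}$ for all $i$; for $x\in\mathcal{M}$, $x\leq\xi$ means $x\leq c_1\cdot\ldots\cdot c_{\tau(x)}$, and $\uparrow x=\{\xi\in\partial\mathcal{M}: x\leq\xi\}$. $\partial\mathcal{M}$ carries the $\sigma$-algebra generated by the sets $\uparrow x$. The Möbius transform of $f:\mathscr{C}\to\mathbb{R}$ is $h(c)=\sum_{c'\in\mathscr{C}:c'\geq c}(-1)^{|c'|-|c|}f(c')$. A fibred valuation is a family $(f_\alpha)_{\alpha\in X}$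 of maps $\mathcal{M}\to\mathbb{R}$ with $f_\alpha(1)=1$ and $f_\alpha(x\cdot y)=f_\alpha(x)f_{\alpha\cdot x}(y)$. *)

theory Defs
  imports "HOL-Probability.Probability" "HOL-Algebra.Divisibility"
begin

inductive trace_eq :: "'a rel \<Rightarrow> 'a list \<Rightarrow> 'a list \<Rightarrow> bool" for I where
  comm: "(a, b) \<in> I \<Longrightarrow> trace_eq I [a, b] [b, a]"
| refl: "trace_eq I u u"
| sym: "trace_eq I u v \<Longrightarrow> trace_eq I v u"
| trans: "trace_eq I u v \<Longrightarrow> trace_eq I v w \<Longrightarrow> trace_eq I u w"
| append: "trace_eq I u u' \<Longrightarrow> trace_eq I v v' \<Longrightarrow> trace_eq I (u @ v) (u' @ v')"

definition trace_cong :: "'a rel \<Rightarrow> 'a list rel" where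
  "trace_cong I = {(u, v). trace_eq I u v}"

definition trace_of :: "'a rel \<Rightarrow> 'a list \<Rightarrow> 'a list set" where
  "trace_of I w = trace_cong I `` {w}"

definition trace_monoid :: "'a rel \<Rightarrow> 'a list set monoid" where
  "trace_monoid I =
     \<lparr>carrier = UNIV // trace_cong I,
      mult = (\<lambda>x y. \<Union>u\<in>x. \<Union>v\<in>y. trace_of I (u @ v)),
      one = trace_of I []\<rparr>"

lemma equiv_trace_cong: "equiv UNIV (trace_cong I)"
proof (rule equivI)
  show "trace_cong I \<subseteq> UNIV \<times> UNIV"
    by simp
  show "refl (trace_cong I)"
    by (simp add: refl_on_def trace_cong_def trace_eq.refl)
  show "Relation.sym (trace_cong I)"
    unfolding trace_cong_def by (rule symI) (simp, rule trace_eq.sym)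
  show "Relation.trans (trace_cong I)"
    unfolding trace_cong_def by (rule transI) (simp, rule trace_eq.trans)
qed

lemma trace_of_eq_iff: "trace_of I u = trace_of I v \<longleftrightarrow> trace_eq I u v"
  unfolding trace_of_def using eq_equiv_class_iff[OF equiv_trace_cong, of u v I]
  by (simp add: trace_cong_def)

lemma carrier_trace_monoid: "carrier (trace_monoid I) = range (trace_of I)"
  by (auto simp: trace_monoid_def trace_of_def quotient_def)

lemma mult_trace_of:
  "trace_of I u \<otimes>\<^bsub>trace_monoid I\<^esub> trace_of I v = trace_of I (u @ v)"
proof -
  have "trace_of I (u' @ v') = trace_of I (u @ v)"
    if "u' \<in> trace_of I u" "v' \<in> trace_of I v" for u' v'
  proof -
    have "trace_eq I u u'" "trace_eq I v v'"
      using that by (auto simp: trace_of_def trace_cong_def)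
    then show ?thesis
      unfolding trace_of_eq_iff by (rule trace_eq.sym[OF trace_eq.append])
  qed
  moreover have "w \<in> trace_of I w" for w
    by (simp add: trace_of_def trace_cong_def trace_eq.refl)
  ultimately have "(\<Union>u'\<in>trace_of I u. \<Union>v'\<in>trace_of I v. trace_of I (u' @ v')) = trace_of I (u @ v)"
    by blast
  then show ?thesis
    by (simp add: trace_monoid_def)
qed

lemma one_trace_monoid: "\<one>\<^bsub>trace_monoid I\<^esub> = trace_of I []"
  by (simp add: trace_monoid_def)

lemma monoid_trace_monoid: "monoid (trace_monoid I)"
  by (rule monoidI) (auto simp: carrier_trace_monoid mult_trace_of one_trace_monoid)

definition trace_prod :: "'a rel \<Rightarrow> 'a list set list \<Rightarrow> 'a list set" where
  "trace_prod I xs = foldr (\<lambda>x y. x \<otimes>\<^bsub>trace_monoid I\<^esub> y) xs \<one>\<^bsub>trace_monoid I\<^esub>"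

definition right_action :: "'a rel \<Rightarrow> ('x \<Rightarrow> 'a list set \<Rightarrow> 'x) \<Rightarrow> bool" where
  "right_action I act \<longleftrightarrow>
     (\<forall>\<alpha>. act \<alpha> \<one>\<^bsub>trace_monoid I\<^esub> = \<alpha>) \<and>
     (\<forall>\<alpha>. \<forall>x\<in>carrier (trace_monoid I). \<forall>y\<in>carrier (trace_monoid I).
        act (act \<alpha> x) y = act \<alpha> (x \<otimes>\<^bsub>trace_monoid I\<^esub> y))"

text \<open>Cliques are represented by sets of letters; \<open>clique_trace\<close> is the identification of a
  clique with a trace. It does not depend on the chosen enumeration (\<open>clique_trace_eq\<close>), and
  divisibility of cliques is inclusion (\<open>clique_divides_iff\<close>).\<close>

definition cliques :: "'a rel \<Rightarrow> 'a set set" where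
  "cliques I = {c. finite c \<and> (\<forall>a\<in>c. \<forall>b\<in>c. a \<noteq> b \<longrightarrow> (a, b) \<in> I)}"

abbreviation nonempty_cliques :: "'a rel \<Rightarrow> 'a set set" where
  "nonempty_cliques I \<equiv> cliques I - {{}}"

definition clique_trace :: "'a rel \<Rightarrow> 'a set \<Rightarrow> 'a list set" where
  "clique_trace I c = trace_of I (SOME w. distinct w \<and> set w = c)"

definition clique_arrow :: "'a rel \<Rightarrow> 'a set \<Rightarrow> 'a set \<Rightarrow> bool" where
  "clique_arrow I c c' \<longleftrightarrow> (\<forall>b\<in>c'. \<exists>a\<in>c. (a, b) \<notin> I)"

lemma trace_eq_move_front:
  assumes "\<And>b. b \<in> set u \<Longrightarrow> (b, a) \<in> I"
  shows "trace_eq I (u @ [a]) (a # u)"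
  using assms
proof (induction u)
  case Nil
  show ?case by (simp add: trace_eq.refl)
next
  case (Cons b u)
  have "trace_eq I ([b] @ (u @ [a])) ([b] @ (a # u))"
    using Cons by (intro trace_eq.append trace_eq.refl) simp
  moreover have "trace_eq I ([b, a] @ u) ([a, b] @ u)"
    using Cons.prems by (intro trace_eq.append trace_eq.refl trace_eq.comm) simp
  ultimately show ?case by simp (rule trace_eq.trans)
qed

lemma trace_eq_enumeration:
  assumes "distinct v" "distinct w" "set v = set w" "set v \<in> cliques I"
  shows "trace_eq I v w"
  using assms
proof (induction w arbitrary: v)
  case Nil
  then show ?case by (simp add: trace_eq.refl)
next
  case (Cons a w)
  then obtain v1 v2 where v: "v = v1 @ a # v2"
    by (metis list.set_intros(1) split_list)
  have "trace_eq I (v1 @ [a]) (a # v1)"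
    using Cons.prems v by (intro trace_eq_move_front) (auto simp: cliques_def)
  then have "trace_eq I ((v1 @ [a]) @ v2) ((a # v1) @ v2)"
    by (intro trace_eq.append trace_eq.refl)
  moreover have "trace_eq I (v1 @ v2) w"
  proof (rule Cons.IH)
    show "set (v1 @ v2) = set w"
      using Cons.prems v by (auto simp: insert_eq_iff)
    then show "set (v1 @ v2) \<in> cliques I"
      using Cons.prems by (auto simp: cliques_def)
  qed (use Cons.prems v in auto)
  then have "trace_eq I ([a] @ (v1 @ v2)) ([a] @ w)"
    by (intro trace_eq.append trace_eq.refl)
  ultimately show ?case
    unfolding v by simp (rule trace_eq.trans)
qed

lemma clique_trace_eq:
  assumes "c \<in> cliques I" "distinct w" "set w = c"
  shows "clique_trace I c = trace_of I w"
proof -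
  let ?v = "SOME v. distinct v \<and> set v = c"
  have "distinct ?v \<and> set ?v = c"
    by (rule someI[of _ w]) (use assms in auto)
  then show ?thesis
    unfolding clique_trace_def trace_of_eq_iff
    using assms by (intro trace_eq_enumeration) auto
qed

lemma trace_eq_set: "trace_eq I u v \<Longrightarrow> set u = set v"
  by (induction rule: trace_eq.induct) auto

lemma clique_divides_iff:
  assumes "c \<in> cliques I" "c' \<in> cliques I"
  shows "clique_trace I c divides\<^bsub>trace_monoid I\<^esub> clique_trace I c' \<longleftrightarrow> c \<subseteq> c'"
proof -
  have fin: "finite c" "finite c'"
    using assms by (simp_all add: cliques_def)
  obtain w where w: "distinct w" "set w = c"
    using finite_distinct_list[OF fin(1)] by metis
  obtain w' where w': "distinct w'" "set w' = c'"
    using finite_distinct_list[OF fin(2)] by metis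
  have eq: "clique_trace I c = trace_of I w" "clique_trace I c' = trace_of I w'"
    by (rule clique_trace_eq[OF assms(1) w], rule clique_trace_eq[OF assms(2) w'])
  show ?thesis
  proof
    assume "clique_trace I c divides\<^bsub>trace_monoid I\<^esub> clique_trace I c'"
    then obtain v where "trace_eq I w' (w @ v)"
      by (auto simp: factor_def eq carrier_trace_monoid mult_trace_of trace_of_eq_iff)
    then show "c \<subseteq> c'"
      using trace_eq_set[of I w' "w @ v"] w w' by simp
  next
    assume "c \<subseteq> c'"
    then obtain v where v: "distinct v" "set v = c' - c"
      using finite_distinct_list[OF finite_Diff[OF fin(2)], of c] by metis
    have "clique_trace I c' = trace_of I (w @ v)"
      using assms w v \<open>c \<subseteq> c'\<close> by (intro clique_trace_eq) auto
    then have "clique_trace I c' = clique_trace I c \<otimes>\<^bsub>trace_monoid I\<^esub> trace_of I v"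
      by (simp add: eq(1) mult_trace_of)
    then show "clique_trace I c divides\<^bsub>trace_monoid I\<^esub> clique_trace I c'"
      unfolding factor_def carrier_trace_monoid by blast
  qed
qed

definition clique_decomp :: "'a rel \<Rightarrow> 'a list set \<Rightarrow> 'a set list \<Rightarrow> bool" where
  "clique_decomp I x cs \<longleftrightarrow>
     set cs \<subseteq> nonempty_cliques I \<and>
     (\<forall>i. Suc i < length cs \<longrightarrow> clique_arrow I (cs ! i) (cs ! Suc i)) \<and>
     x = trace_prod I (map (clique_trace I) cs)"

definition trace_height :: "'a rel \<Rightarrow> 'a list set \<Rightarrow> nat" where
  "trace_height I x = length (THE cs. clique_decomp I x cs)"

text \<open>Sequences are indexed from \<open>0\<close>: \<open>\<xi> i\<close> is the clique $c_{i+1}$, and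
  \<open>boundary_prefix I \<xi> n\<close> is $c_1 \cdot \ldots \cdot c_n$.\<close>

definition boundary :: "'a rel \<Rightarrow> (nat \<Rightarrow> 'a set) set" where
  "boundary I = {\<xi>. \<forall>i. \<xi> i \<in> nonempty_cliques I \<and> clique_arrow I (\<xi> i) (\<xi> (Suc i))}"

definition boundary_prefix :: "'a rel \<Rightarrow> (nat \<Rightarrow> 'a set) \<Rightarrow> nat \<Rightarrow> 'a list set" where
  "boundary_prefix I \<xi> n = trace_prod I (map (\<lambda>i. clique_trace I (\<xi> i)) [0..<n])"

definition up :: "'a rel \<Rightarrow> 'a list set \<Rightarrow> (nat \<Rightarrow> 'a set) set" where
  "up I x = {\<xi> \<in> boundary I. x divides\<^bsub>trace_monoid I\<^esub> boundary_prefix I \<xi> (trace_height I x)}"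

definition boundary_algebra :: "'a rel \<Rightarrow> (nat \<Rightarrow> 'a set) measure" where
  "boundary_algebra I = sigma (boundary I) (up I ` carrier (trace_monoid I))"

definition markov_measure ::
  "'a rel \<Rightarrow> ('x \<Rightarrow> 'a list set \<Rightarrow> 'x) \<Rightarrow> ('x \<Rightarrow> (nat \<Rightarrow> 'a set) measure) \<Rightarrow> bool" where
  "markov_measure I act P \<longleftrightarrow>
     (\<forall>\<alpha>. prob_space (P \<alpha>) \<and> sets (P \<alpha>) = sets (boundary_algebra I)) \<and>
     (\<forall>\<alpha>. \<forall>x\<in>carrier (trace_monoid I). \<forall>y\<in>carrier (trace_monoid I).
        measure (P \<alpha>) (up I (x \<otimes>\<^bsub>trace_monoid I\<^esub> y)) =
        measure (P \<alpha>) (up I x) * measure (P (act \<alpha> x)) (up I y))"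

definition moebius_transform :: "'a rel \<Rightarrow> ('a set \<Rightarrow> real) \<Rightarrow> 'a set \<Rightarrow> real" where
  "moebius_transform I f c =
     (\<Sum>c'\<in>{c' \<in> cliques I. c \<subseteq> c'}. (-1) ^ (card c' - card c) * f c')"

definition fibred_valuation ::
  "'a rel \<Rightarrow> ('x \<Rightarrow> 'a list set \<Rightarrow> 'x) \<Rightarrow> ('x \<Rightarrow> 'a list set \<Rightarrow> real) \<Rightarrow> bool" where
  "fibred_valuation I act f \<longleftrightarrow>
     (\<forall>\<alpha>. f \<alpha> \<one>\<^bsub>trace_monoid I\<^esub> = 1) \<and>
     (\<forall>\<alpha>. \<forall>x\<in>carrier (trace_monoid I). \<forall>y\<in>carrier (trace_monoid I).
        f \<alpha> (x \<otimes>\<^bsub>trace_monoid I\<^esub> y) = f \<alpha> x * f (act \<alpha> x) y)"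

definition moebius_fibred_valuation ::
  "'a rel \<Rightarrow> ('x \<Rightarrow> 'a list set \<Rightarrow> 'x) \<Rightarrow> ('x \<Rightarrow> 'a list set \<Rightarrow> real) \<Rightarrow> bool" where
  "moebius_fibred_valuation I act f \<longleftrightarrow>
     fibred_valuation I act f \<and>
     (\<forall>\<alpha>. moebius_transform I (\<lambda>c. f \<alpha> (clique_trace I c)) {} = 0 \<and>
       (\<forall>\<gamma>\<in>nonempty_cliques I. moebius_transform I (\<lambda>c. f \<alpha> (clique_trace I c)) \<gamma> \<ge> 0))"

text \<open>The rows of \<open>Q\<close> at states that are almost surely never visited are unconstrained.\<close>

definition chain_with_transitions ::
  "'w measure \<Rightarrow> 's set \<Rightarrow> (nat \<Rightarrow> 'w \<Rightarrow> 's) \<Rightarrow> ('s \<Rightarrow> 's \<Rightarrow> real) \<Rightarrow> bool" where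
  "chain_with_transitions M S Z Q \<longleftrightarrow>
     (\<forall>n. Z n \<in> measurable M (count_space S)) \<and>
     (\<forall>n s t. (\<forall>i\<le>n. s i \<in> S) \<longrightarrow> t \<in> S \<longrightarrow> \<P>(\<omega> in M. \<forall>i\<le>n. Z i \<omega> = s i) > 0 \<longrightarrow>
        \<P>(\<omega> in M. Z (Suc n) \<omega> = t \<bar> \<forall>i\<le>n. Z i \<omega> = s i) = Q (s n) t)"

definition homogeneous_markov_chain ::
  "'w measure \<Rightarrow> 's set \<Rightarrow> (nat \<Rightarrow> 'w \<Rightarrow> 's) \<Rightarrow> bool" where
  "homogeneous_markov_chain M S Z \<longleftrightarrow>
     (\<exists>Q. (\<forall>s\<in>S. (\<forall>t\<in>S. Q s t \<ge> 0) \<and> (Q s has_sum 1) S) \<and> chain_with_transitions M S Z Q)"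

definition state_clique ::
  "'a rel \<Rightarrow> ('x \<Rightarrow> 'a list set \<Rightarrow> 'x) \<Rightarrow> 'x \<Rightarrow> nat \<Rightarrow> (nat \<Rightarrow> 'a set) \<Rightarrow> 'x \<times> 'a set" where
  "state_clique I act \<alpha>\<^sub>0 i \<xi> = (act \<alpha>\<^sub>0 (boundary_prefix I \<xi> i), \<xi> i)"

definition normalization_factor :: "'a rel \<Rightarrow> ('x \<Rightarrow> 'a set \<Rightarrow> real) \<Rightarrow> 'x \<Rightarrow> 'a set \<Rightarrow> real" where
  "normalization_factor I h \<alpha> \<gamma> = (\<Sum>\<gamma>'\<in>{\<gamma>' \<in> nonempty_cliques I. clique_arrow I \<gamma> \<gamma>'}. h \<alpha> \<gamma>')"

text \<open>The convention that the entry is \<open>0\<close> when the denominator vanishes is that of division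
  in HOL.\<close>

definition transition_matrix ::
  "'a rel \<Rightarrow> ('x \<Rightarrow> 'a list set \<Rightarrow> 'x) \<Rightarrow> ('x \<Rightarrow> 'a set \<Rightarrow> real) \<Rightarrow>
   'x \<times> 'a set \<Rightarrow> 'x \<times> 'a set \<Rightarrow> real" where
  "transition_matrix I act h = (\<lambda>(\<alpha>, \<gamma>) (\<alpha>', \<gamma>').
     of_bool (\<alpha>' = act \<alpha> (clique_trace I \<gamma>)) * of_bool (clique_arrow I \<gamma> \<gamma>') *
     (h \<alpha>' \<gamma>' / normalization_factor I h \<alpha>' \<gamma>))"

end

(* Let x be a product of cliques c_1 ... c_k, normal or not. By the greedy description of normal
   forms, x <= xi can be tested on Y_k. If moreover z is the residual with Y_(k+1) = x z, then the
   clique E of initial letters of z satisfies: xi lies above x c iff c is contained in E. Moebius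
   inversion over cliques therefore gives P_alpha(x <= xi, E = d) = f_alpha(x) h_(alpha x)(d).
   For x = 1 the clique E is C_1, which yields h >= 0 and h(1) = 0. When (c_1, ..., c_k, d) is
   normal the event is {C_1 = c_1, ..., C_k = c_k, C_(k+1) = d}; summing over d gives
   h_alpha(c) = f_alpha(c) g_(alpha c)(c), and the transition probabilities are quotients of
   consecutive cylinder probabilities. *)

theory Submission
  imports Defs
begin

section \<open>Words modulo commutation: initial letters, divisibility, cancellation\<close>

text \<open>The letters that commutations can bring to the front of the word. For irreflexive
  symmetric \<open>I\<close> this is the largest clique dividing the trace, hence the first clique
  of its normal form. It is computed on a representative; \<open>trace_eq_initials\<close> shows
  that the choice does not matter.\<close>

primrec initials :: "'a rel \<Rightarrow> 'a list \<Rightarrow> 'a set" where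
  "initials I [] = {}"
| "initials I (x # w) = insert x {b \<in> initials I w. (x, b) \<in> I}"

text \<open>Divisibility read on representatives, so that the arguments can stay with words;
  \<open>divides_trace_of_iff\<close> is the bridge to the monoid.\<close>

definition trace_le :: "'a rel \<Rightarrow> 'a list \<Rightarrow> 'a list \<Rightarrow> bool" where
  "trace_le I u v \<longleftrightarrow> (\<exists>t. trace_eq I v (u @ t))"

text \<open>The same choice as in \<open>clique_trace\<close>, so that the two notions are linked by
  unfolding alone.\<close>

definition clique_word :: "'a set \<Rightarrow> 'a list" where
  "clique_word c = (SOME w. distinct w \<and> set w = c)"

abbreviation cliques_word :: "'a set list \<Rightarrow> 'a list" where
  "cliques_word cs \<equiv> concat (map clique_word cs)"

text \<open>The Cartier-Foata normal form, detached from the trace that it decomposes.\<close>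

definition normal_cliques :: "'a rel \<Rightarrow> 'a set list \<Rightarrow> bool" where
  "normal_cliques I cs \<longleftrightarrow> set cs \<subseteq> nonempty_cliques I \<and> successively (clique_arrow I) cs"

lemma trace_of_in_carrier [simp]: "trace_of I w \<in> carrier (trace_monoid I)"
  by (simp add: carrier_trace_monoid)

lemma trace_eq_Cons: "trace_eq I u v \<Longrightarrow> trace_eq I (x # u) (x # v)"
  using trace_eq.append[OF trace_eq.refl[of I "[x]"]] by fastforce

lemma trace_eq_append_left: "trace_eq I u v \<Longrightarrow> trace_eq I (w @ u) (w @ v)"
  by (intro trace_eq.append trace_eq.refl)

lemma trace_eq_length: "trace_eq I u v \<Longrightarrow> length u = length v"
  by (induction rule: trace_eq.induct) auto

lemma trace_le_trans: "trace_le I u v \<Longrightarrow> trace_le I v w \<Longrightarrow> trace_le I u w"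
  unfolding trace_le_def
  by (metis append.assoc trace_eq.append trace_eq.refl trace_eq.trans)

lemma trace_le_append: "trace_le I u (u @ v)"
  unfolding trace_le_def using trace_eq.refl by blast

lemma trace_le_refl: "trace_le I u u"
  using trace_le_append[of I u "[]"] by simp

lemma trace_le_cong:
  "trace_eq I u u' \<Longrightarrow> trace_eq I v v' \<Longrightarrow> trace_le I u v \<longleftrightarrow> trace_le I u' v'"
  unfolding trace_le_def
  by (meson trace_eq.append trace_eq.refl trace_eq.sym trace_eq.trans)

lemma divides_trace_of_iff:
  "trace_of I u divides\<^bsub>trace_monoid I\<^esub> trace_of I v \<longleftrightarrow> trace_le I u v"
  by (auto simp: factor_def trace_le_def carrier_trace_monoid mult_trace_of trace_of_eq_iff)

text \<open>Serves left cancellation: deleting a first occurrence strips a common leading letter.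
  Equivalent words have the same letters, so in a concatenation the deletion hits the same factor on
  both sides.\<close>

lemma trace_eq_remove1:
  "trace_eq I u v \<Longrightarrow> trace_eq I (remove1 a u) (remove1 a v)"
proof (induction rule: trace_eq.induct)
  case (comm x y)
  then show ?case by (auto intro: trace_eq.intros)
next
  case (append u u' v v')
  then show ?case
    using trace_eq_set[OF append.hyps(1)]
    by (auto simp: remove1_append intro: trace_eq.append)
qed (auto intro: trace_eq.intros)

lemma trace_eq_append_cancel: "trace_eq I (u @ v) (u @ w) \<longleftrightarrow> trace_eq I v w"
proof
  show "trace_eq I v w" if "trace_eq I (u @ v) (u @ w)"
    using that
  proof (induction u)
    case (Cons a u)
    then show ?case
      using trace_eq_remove1[of I "a # u @ v" "a # u @ w" a] by simp
  qed simp
qed (rule trace_eq_append_left)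

lemma trace_le_append_cancel: "trace_le I (u @ v) (u @ w) \<longleftrightarrow> trace_le I v w"
  by (simp add: trace_le_def trace_eq_append_cancel)

lemma initials_append:
  "initials I (u @ v) = initials I u \<union> {b \<in> initials I v. \<forall>x\<in>set u. (x, b) \<in> I}"
  by (induction u) auto

lemma initials_eq_empty_iff [simp]: "initials I w = {} \<longleftrightarrow> w = []"
  by (cases w) auto

text \<open>Every letter ahead of the first occurrence of \<open>a\<close> commutes with
  \<open>a\<close>, so this occurrence can be moved to the front step by step.\<close>

lemma trace_eq_initials_Cons: "a \<in> initials I w \<Longrightarrow> trace_eq I w (a # remove1 a w)"
proof (induction w)
  case (Cons x w)
  show ?case
  proof (cases "a = x")
    case False
    with Cons have "trace_eq I (x # w) (x # a # remove1 a w)" "(x, a) \<in> I"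
      by (auto intro: trace_eq_Cons)
    moreover from this have "trace_eq I ([x, a] @ remove1 a w) ([a, x] @ remove1 a w)"
      by (intro trace_eq.append trace_eq.comm trace_eq.refl)
    ultimately show ?thesis
      using False by (auto intro: trace_eq.trans)
  qed (simp add: trace_eq.refl)
qed simp

lemma initials_clique: "set w \<in> cliques I \<Longrightarrow> initials I w = set w"
  by (induction w) (auto simp: cliques_def)

lemma clique_word:
  assumes "c \<in> cliques I"
  shows "distinct (clique_word c)" "set (clique_word c) = c"
proof -
  have "finite c"
    using assms by (simp add: cliques_def)
  then have "\<exists>w. distinct w \<and> set w = c"
    using finite_distinct_list by blast
  then have "distinct (clique_word c) \<and> set (clique_word c) = c"
    unfolding clique_word_def by (rule someI_ex)
  then show "distinct (clique_word c)" "set (clique_word c) = c"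
    by auto
qed

lemma clique_trace_clique_word: "clique_trace I c = trace_of I (clique_word c)"
  by (simp add: clique_trace_def clique_word_def)

lemma clique_word_empty [simp]: "clique_word {} = []"
  unfolding clique_word_def by (rule some_equality) auto

lemma initials_clique_word [simp]: "c \<in> cliques I \<Longrightarrow> initials I (clique_word c) = c"
  using clique_word(2)[of c I] by (metis initials_clique)

lemma trace_prod_clique_trace:
  "trace_prod I (map (clique_trace I) cs) = trace_of I (cliques_word cs)"
  by (induction cs)
    (auto simp: trace_prod_def one_trace_monoid clique_trace_clique_word mult_trace_of)

lemma boundary_prefix_eq: "boundary_prefix I \<xi> n = trace_of I (cliques_word (map \<xi> [0..<n]))"
  unfolding boundary_prefix_def trace_prod_clique_trace[symmetric] by (simp add: o_def)

lemma clique_decomp_iff: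
  "clique_decomp I (trace_of I w) cs \<longleftrightarrow> normal_cliques I cs \<and> trace_eq I w (cliques_word cs)"
  by (auto simp: clique_decomp_def normal_cliques_def successively_conv_nth
      trace_prod_clique_trace trace_of_eq_iff)

lemma normal_cliques_boundary: "\<xi> \<in> boundary I \<Longrightarrow> normal_cliques I (map \<xi> [0..<n])"
  by (auto simp: boundary_def normal_cliques_def successively_conv_nth)

section \<open>Normal forms: existence, uniqueness, height\<close>

locale independence =
  fixes I :: "'a rel"
  assumes irrefl_I: "irrefl I" and sym_I: "sym I"
begin

text \<open>Symmetry of \<open>I\<close> enters at the generating swap, where both orders must
  expose both letters. For concatenations, only the set of letters of the left factor matters, and
  it is invariant.\<close>

lemma trace_eq_initials: "trace_eq I u v \<Longrightarrow> initials I u = initials I v"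
proof (induction rule: trace_eq.induct)
  case (comm a b)
  then show ?case using sym_I by (auto dest: symD)
next
  case (append u u' v v')
  then show ?case
    using trace_eq_set[OF append.hyps(1)] by (simp add: initials_append)
qed auto

lemma initials_in_cliques: "initials I w \<in> cliques I"
  using sym_I by (induction w) (auto simp: cliques_def dest: symD)

text \<open>Turns divisibility by a clique into an inclusion of sets. Conversely to the invariance
  of \<open>initials\<close>, the letters of \<open>e\<close> are moved to the front and cancelled
  one at a time.\<close>

lemma clique_le_iff:
  assumes "distinct e" "set e \<in> cliques I"
  shows "trace_le I e w \<longleftrightarrow> set e \<subseteq> initials I w"
proof
  assume "trace_le I e w"
  then obtain t where "trace_eq I w (e @ t)"
    by (auto simp: trace_le_def)
  then show "set e \<subseteq> initials I w"
    using assms by (auto simp: trace_eq_initials initials_append initials_clique)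
next
  show "set e \<subseteq> initials I w \<Longrightarrow> trace_le I e w"
    using assms
  proof (induction e arbitrary: w)
    case Nil
    then show ?case by (auto simp: trace_le_def intro: trace_eq.refl)
  next
    case (Cons a e)
    have eq: "trace_eq I w (a # remove1 a w)"
      using Cons.prems by (intro trace_eq_initials_Cons) auto
    \<comment> \<open>By distinctness no letter of \<open>e\<close> equals \<open>a\<close>, so each
      of them was initial behind the leading \<open>a\<close> and stays initial once
      \<open>a\<close> is removed.\<close>
    have "set e \<subseteq> initials I (remove1 a w)"
      using Cons.prems trace_eq_initials[OF eq] by auto
    then have "trace_le I e (remove1 a w)"
      using Cons.prems by (intro Cons.IH) (auto simp: cliques_def)
    then have "trace_le I ([a] @ e) ([a] @ remove1 a w)"
      unfolding trace_le_append_cancel .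
    then show ?case
      using trace_le_cong[OF trace_eq.refl eq] by simp
  qed
qed

lemma clique_word_le_iff:
  "c \<in> cliques I \<Longrightarrow> trace_le I (clique_word c) w \<longleftrightarrow> c \<subseteq> initials I w"
  using clique_le_iff[of "clique_word c" w] clique_word[of c I] by simp

text \<open>Each letter of the second clique is blocked by some letter of \<open>c\<close> with
  which it does not commute, so nothing behind \<open>c\<close> reaches the front.\<close>

lemma initials_normal_cliques:
  assumes "normal_cliques I (c # cs)"
  shows "initials I (cliques_word (c # cs)) = c"
  using assms
proof (induction cs arbitrary: c)
  case Nil
  then show ?case
    by (simp add: normal_cliques_def)
next
  case (Cons d cs)
  have c: "c \<in> cliques I" and arrow: "clique_arrow I c d" and "normal_cliques I (d # cs)"
    using Cons.prems by (auto simp: normal_cliques_def)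
  then have "initials I (cliques_word (d # cs)) = d"
    by (intro Cons.IH)
  then show ?case
    using c arrow initials_append[of I "clique_word c" "cliques_word (d # cs)"]
      clique_word(2)[OF c]
    by (auto simp: clique_arrow_def)
qed

text \<open>The trace determines the first clique through \<open>initials\<close>; cancelling it
  leaves a shorter instance.\<close>

lemma normal_cliques_unique:
  assumes "normal_cliques I cs" "normal_cliques I ds"
    and "trace_eq I (cliques_word cs) (cliques_word ds)"
  shows "cs = ds"
  using assms
proof (induction cs arbitrary: ds)
  case Nil
  have False if "ds = d # ds'" for d ds'
    using Nil initials_normal_cliques[of d ds'] trace_eq_initials[of "[]" "cliques_word ds"] that
    by (auto simp: normal_cliques_def)
  then show ?case by (cases ds) auto
next
  case (Cons c cs)
  have c: "initials I (cliques_word (c # cs)) = c" "c \<noteq> {}"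
    using Cons.prems initials_normal_cliques[of c cs] by (auto simp: normal_cliques_def)
  then obtain d ds' where ds: "ds = d # ds'"
    using Cons.prems trace_eq_initials[OF Cons.prems(3)] by (cases ds) auto
  have "d = c"
    using c initials_normal_cliques[of d ds'] trace_eq_initials[OF Cons.prems(3)] Cons.prems(2) ds
    by simp
  then have "trace_eq I (cliques_word cs) (cliques_word ds')"
    using Cons.prems(3) ds by (simp add: trace_eq_append_cancel)
  then have "cs = ds'"
    using Cons.prems ds by (intro Cons.IH) (auto simp: normal_cliques_def successively_Cons)
  then show ?case
    using ds \<open>d = c\<close> by simp
qed

text \<open>Greedy construction: split off the clique of all initial letters and recurse on the
  shorter rest.\<close>

lemma normal_cliques_exists: "\<exists>cs. normal_cliques I cs \<and> trace_eq I w (cliques_word cs)"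
proof (induction "length w" arbitrary: w rule: less_induct)
  case less
  show ?case
  proof (cases "w = []")
    case True
    then show ?thesis
      by (intro exI[of _ "[]"]) (auto simp: normal_cliques_def intro: trace_eq.refl)
  next
    case False
    define c where "c = initials I w"
    have c: "c \<in> cliques I" "c \<noteq> {}"
      using False by (simp_all add: c_def initials_in_cliques)
    then have "trace_le I (clique_word c) w"
      by (simp add: clique_word_le_iff c_def)
    then obtain t where t: "trace_eq I w (clique_word c @ t)"
      by (auto simp: trace_le_def)
    have "clique_word c \<noteq> []"
      using c clique_word(2)[OF c(1)] by auto
    then have "length t < length w"
      using trace_eq_length[OF t] by simp
    from less[OF this] obtain cs where
      cs: "normal_cliques I cs" "trace_eq I t (cliques_word cs)" by auto
    \<comment> \<open>A letter \<open>b\<close> of the next clique commuting with all of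
      \<open>c\<close> would already be initial in \<open>w\<close>, hence lie in \<open>c\<close>
      and commute with itself, against irreflexivity.\<close>
    have "clique_arrow I c d" if "cs = d # ds" for d ds
      unfolding clique_arrow_def
    proof (rule ballI, rule ccontr)
      fix b assume b: "b \<in> d" "\<not> (\<exists>a\<in>c. (a, b) \<notin> I)"
      have "initials I t = d"
        using trace_eq_initials[OF cs(2)] initials_normal_cliques[of d ds] cs(1) that by simp
      then have "b \<in> initials I (clique_word c @ t)"
        using b clique_word(2)[OF c(1)] by (auto simp: initials_append)
      then have "b \<in> c"
        using trace_eq_initials[OF t, folded c_def] by simp
      then show False
        using b irrefl_I by (auto simp: irrefl_def)
    qed
    then have "normal_cliques I (c # cs)"
      using c cs(1) by (cases cs) (auto simp: normal_cliques_def)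
    moreover have "trace_eq I w (cliques_word (c # cs))"
      using trace_eq.trans[OF t trace_eq_append_left[OF cs(2)]] by simp
    ultimately show ?thesis by blast
  qed
qed

lemma trace_height_eq:
  assumes "normal_cliques I cs" "trace_eq I w (cliques_word cs)"
  shows "trace_height I (trace_of I w) = length cs"
proof -
  have "ds = cs" if "normal_cliques I ds" "trace_eq I w (cliques_word ds)" for ds
    using normal_cliques_unique[OF that(1) assms(1)] that(2) assms(2)
    by (meson trace_eq.sym trace_eq.trans)
  then have "(THE cs. clique_decomp I (trace_of I w) cs) = cs"
    unfolding clique_decomp_iff using assms by (intro the_equality) blast+
  then show ?thesis by (simp add: trace_height_def)
qed

text \<open>A letter that is initial in \<open>q @ r\<close> and not in \<open>q\<close> is initial in \<open>r\<close>; hence the last clique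
  of a product of \<open>k\<close> cliques never needs more than the \<open>k\<close>-th clique of the normal form.\<close>

lemma trace_le_take:
  assumes "set es \<subseteq> cliques I" "normal_cliques I cs"
    and "trace_le I (cliques_word es) (cliques_word cs)"
  shows "trace_le I (cliques_word es) (cliques_word (take (length es) cs))"
  using assms
proof (induction es rule: rev_induct)
  case Nil
  then show ?case by (simp add: trace_le_refl)
next
  case (snoc d es)
  let ?k = "length es"
  show ?case
  proof (cases "?k < length cs")
    case False
    then show ?thesis using snoc.prems by simp
  next
    case True
    let ?r = "cliques_word (drop ?k cs)"
    have drop: "drop ?k cs = cs ! ?k # drop (Suc ?k) cs"
      using True by (simp add: Cons_nth_drop_Suc)
    have ck: "cs ! ?k \<in> cliques I"
      using snoc.prems(2) nth_mem[OF True] by (auto simp: normal_cliques_def)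
    have "normal_cliques I (take ?k cs @ drop ?k cs)"
      using snoc.prems(2) by simp
    then have nr: "normal_cliques I (drop ?k cs)"
      unfolding normal_cliques_def set_append successively_append_iff by blast
    have ir: "initials I ?r = cs ! ?k"
      using initials_normal_cliques[OF nr[unfolded drop]] by (simp add: drop)
    have "trace_le I (cliques_word es) (cliques_word (es @ [d]))"
      using trace_le_append by simp
    then have "trace_le I (cliques_word es) (cliques_word cs)"
      using snoc.prems(3) by (rule trace_le_trans)
    then have "trace_le I (cliques_word es) (cliques_word (take ?k cs))"
      using snoc by simp
    \<comment> \<open>\<open>q\<close> is what the first \<open>?k\<close> cliques leave after
      division by the product of \<open>es\<close>; \<open>?r\<close> is what follows these
      cliques.\<close>
    then obtain q where q: "trace_eq I (cliques_word (take ?k cs)) (cliques_word es @ q)"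
      by (auto simp: trace_le_def)
    have "trace_eq I (cliques_word (take ?k cs) @ ?r) ((cliques_word es @ q) @ ?r)"
      using q by (intro trace_eq.append trace_eq.refl)
    moreover have "cliques_word (take ?k cs) @ ?r = cliques_word cs"
      by (metis append_take_drop_id concat_append map_append)
    ultimately have "trace_eq I (cliques_word cs) (cliques_word es @ q @ ?r)"
      by simp
    then have "trace_le I (cliques_word es @ clique_word d) (cliques_word es @ q @ ?r)"
      using snoc.prems(3) trace_le_cong[OF trace_eq.refl, of I "cliques_word cs"] by simp
    then have "trace_le I (clique_word d) (q @ ?r)"
      unfolding trace_le_append_cancel .
    moreover have d: "d \<in> cliques I"
      using snoc.prems by simp
    ultimately have "d \<subseteq> initials I (q @ ?r)"
      by (simp add: clique_word_le_iff)
    \<comment> \<open>The tail contributes only through its own initial letters, so it may be cut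
      down to its first clique.\<close>
    also have "\<dots> = initials I (q @ clique_word (cs ! ?k))"
      by (simp add: initials_append ir ck)
    finally have "trace_le I (clique_word d) (q @ clique_word (cs ! ?k))"
      using d by (simp add: clique_word_le_iff)
    then have "trace_le I (cliques_word es @ clique_word d)
        (cliques_word es @ q @ clique_word (cs ! ?k))"
      unfolding trace_le_append_cancel .
    moreover have eq: "trace_eq I (cliques_word (take ?k cs) @ clique_word (cs ! ?k))
        ((cliques_word es @ q) @ clique_word (cs ! ?k))"
      using q by (intro trace_eq.append trace_eq.refl)
    ultimately have "trace_le I (cliques_word es @ clique_word d)
        (cliques_word (take ?k cs) @ clique_word (cs ! ?k))"
      using trace_le_cong[OF trace_eq.refl eq] by simp
    then show ?thesis
      using True by (simp add: take_Suc_conv_app_nth)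
  qed
qed

text \<open>Apply \<open>trace_le_take\<close> to the normal form of the product itself: the product
  divides the first \<open>length es\<close> cliques of that form, and comparing lengths leaves no
  room for a further clique.\<close>

lemma trace_height_le:
  assumes "set es \<subseteq> cliques I"
  shows "trace_height I (trace_of I (cliques_word es)) \<le> length es"
proof -
  obtain cs where cs: "normal_cliques I cs" "trace_eq I (cliques_word es) (cliques_word cs)"
    using normal_cliques_exists by blast
  let ?l = "cliques_word (take (length es) cs)" and ?r = "cliques_word (drop (length es) cs)"
  have split: "cliques_word cs = ?l @ ?r"
    by (metis append_take_drop_id concat_append map_append)
  have "trace_le I (cliques_word es) (cliques_word cs)"
    using trace_le_cong[OF cs(2) trace_eq.refl] by (simp add: trace_le_refl)
  then have "trace_le I (cliques_word es) ?l"
    using assms cs(1) by (intro trace_le_take)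
  then obtain t where "trace_eq I ?l (cliques_word es @ t)"
    by (auto simp: trace_le_def)
  then have "length (cliques_word es) \<le> length ?l"
    by (metis le_add1 length_append trace_eq_length)
  moreover have "length (cliques_word es) = length ?l + length ?r"
    using trace_eq_length[OF cs(2)] by (metis split length_append)
  ultimately have "?r = []"
    by (metis add_diff_cancel_left' diff_is_0_eq length_0_conv)
  moreover have "clique_word c \<noteq> []" if "c \<in> set cs" for c
    using that cs(1) clique_word(2)[of c I] by (auto simp: normal_cliques_def)
  ultimately have "c \<notin> set (drop (length es) cs)" for c
    by (auto dest: in_set_dropD)
  then have "drop (length es) cs = []"
    by (metis equals0I set_empty)
  then show ?thesis
    using trace_height_eq[OF cs] by simp
qed

text \<open>Replaces the height in the definition of \<open>up\<close> by the number of factors of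
  any clique factorization. The height is at most this number, prefixes of \<xi> increase, and
  \<open>trace_le_take\<close> for the normal form cuts back to the height.\<close>

lemma up_cliques_word:
  assumes "set es \<subseteq> cliques I"
  shows "up I (trace_of I (cliques_word es)) =
    {\<xi> \<in> boundary I. trace_le I (cliques_word es) (cliques_word (map \<xi> [0..<length es]))}"
proof -
  obtain cs where cs: "normal_cliques I cs" "trace_eq I (cliques_word es) (cliques_word cs)"
    using normal_cliques_exists by blast
  have height: "trace_height I (trace_of I (cliques_word es)) = length cs"
    by (rule trace_height_eq[OF cs])
  then have len: "length cs \<le> length es"
    using trace_height_le[OF assms] by simp
  have "trace_le I (cliques_word es) (cliques_word (map \<xi> [0..<length cs])) \<longleftrightarrow>
      trace_le I (cliques_word es) (cliques_word (map \<xi> [0..<length es]))" (is "?L \<longleftrightarrow> ?R")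
    if \<xi>: "\<xi> \<in> boundary I" for \<xi>
  proof
    assume ?L
    moreover have "[0..<length es] = [0..<length cs] @ [length cs..<length es]"
      using len upt_add_eq_append[of 0 "length cs" "length es - length cs"] by simp
    then have "trace_le I (cliques_word (map \<xi> [0..<length cs])) (cliques_word (map \<xi> [0..<length es]))"
      by (simp add: trace_le_append)
    ultimately show ?R by (rule trace_le_trans)
  next
    assume ?R
    then have "trace_le I (cliques_word cs) (cliques_word (map \<xi> [0..<length es]))"
      using trace_le_cong[OF cs(2) trace_eq.refl] by simp
    then have "trace_le I (cliques_word cs)
        (cliques_word (take (length cs) (map \<xi> [0..<length es])))"
      using cs(1) \<xi> by (intro trace_le_take normal_cliques_boundary) (auto simp: normal_cliques_def)
    then show ?L
      using len trace_le_cong[OF cs(2) trace_eq.refl] by (simp add: take_map)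
  qed
  then show ?thesis
    by (auto simp: up_def height boundary_prefix_eq divides_trace_of_iff)
qed

section \<open>The residual after a product of cliques and its initial letters\<close>

text \<open>The clique E of the proof idea, defined by divisibility so that no residual has to be
  chosen. It is meant for \<xi> above the product of \<open>es\<close>.\<close>

definition next_clique :: "'a set list \<Rightarrow> (nat \<Rightarrow> 'a set) \<Rightarrow> 'a set" where
  "next_clique es \<xi> =
    {a. trace_le I (cliques_word es @ [a]) (cliques_word (map \<xi> [0..<Suc (length es)]))}"

definition cylinder :: "'a set list \<Rightarrow> (nat \<Rightarrow> 'a set) set" where
  "cylinder cs = {\<xi> \<in> boundary I. map \<xi> [0..<length cs] = cs}"

text \<open>The residual is taken in Y_(k+1) for k = \<open>length es\<close>, one clique beyond
  what \<open>up\<close> tests. Cancelling the product turns divisibility by one more letter into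
  being initial in \<open>z\<close>.\<close>

lemma residual:
  assumes "set es \<subseteq> cliques I" "\<xi> \<in> up I (trace_of I (cliques_word es))"
  obtains z where
    "trace_eq I (cliques_word (map \<xi> [0..<Suc (length es)])) (cliques_word es @ z)"
    "next_clique es \<xi> = initials I z"
proof -
  let ?Y = "cliques_word (map \<xi> [0..<Suc (length es)])"
  have "trace_le I (cliques_word es) (cliques_word (map \<xi> [0..<length es]))"
    using assms by (simp add: up_cliques_word)
  moreover have "trace_le I (cliques_word (map \<xi> [0..<length es])) ?Y"
    by (simp add: trace_le_append)
  ultimately have "trace_le I (cliques_word es) ?Y"
    by (rule trace_le_trans)
  then obtain z where z: "trace_eq I ?Y (cliques_word es @ z)"
    by (auto simp: trace_le_def)
  have "trace_le I (cliques_word es @ [a]) ?Y \<longleftrightarrow> a \<in> initials I z" for a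
  proof -
    have "trace_le I (cliques_word es @ [a]) ?Y \<longleftrightarrow> trace_le I [a] z"
      using trace_le_cong[OF trace_eq.refl z] by (simp add: trace_le_append_cancel)
    also have "\<dots> \<longleftrightarrow> a \<in> initials I z"
      by (subst clique_le_iff) (auto simp: cliques_def)
    finally show ?thesis .
  qed
  then show thesis
    using z by (intro that[of z]) (auto simp: next_clique_def)
qed

lemma next_clique_in_cliques:
  assumes "set es \<subseteq> cliques I" "\<xi> \<in> up I (trace_of I (cliques_word es))"
  shows "next_clique es \<xi> \<in> cliques I"
  using residual[OF assms] initials_in_cliques by metis

text \<open>Brings \<open>up\<close> into the shape needed for Moebius inversion: after
  cancellation, the test at k+1 says that \<open>c\<close> divides the residual.\<close>

lemma up_cliques_word_snoc:
  assumes "set es \<subseteq> cliques I" "c \<in> cliques I"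
  shows "up I (trace_of I (cliques_word (es @ [c]))) =
    {\<xi> \<in> up I (trace_of I (cliques_word es)). c \<subseteq> next_clique es \<xi>}"
proof -
  have *: "\<xi> \<in> up I (trace_of I (cliques_word (es @ [c]))) \<longleftrightarrow> c \<subseteq> next_clique es \<xi>"
    if up: "\<xi> \<in> up I (trace_of I (cliques_word es))" for \<xi>
  proof -
    obtain z where z:
      "trace_eq I (cliques_word (map \<xi> [0..<Suc (length es)])) (cliques_word es @ z)"
      "next_clique es \<xi> = initials I z"
      using residual[OF assms(1) up] .
    have "\<xi> \<in> boundary I"
      using up by (simp add: up_def)
    then have "\<xi> \<in> up I (trace_of I (cliques_word (es @ [c]))) \<longleftrightarrow>
        trace_le I (cliques_word es @ clique_word c) (cliques_word (map \<xi> [0..<Suc (length es)]))"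
      using assms up_cliques_word[of "es @ [c]"] by simp
    also have "\<dots> \<longleftrightarrow> trace_le I (clique_word c) z"
      using trace_le_cong[OF trace_eq.refl z(1)] by (simp add: trace_le_append_cancel)
    finally show ?thesis
      using assms(2) z(2) by (simp add: clique_word_le_iff)
  qed
  \<comment> \<open>The test for the longer product is made on k+1 cliques;
    \<open>trace_le_take\<close> brings it back to the first k.\<close>
  have "\<xi> \<in> up I (trace_of I (cliques_word es))"
    if "\<xi> \<in> up I (trace_of I (cliques_word (es @ [c])))" for \<xi>
  proof -
    have \<xi>: "\<xi> \<in> boundary I"
      using that by (simp add: up_def)
    have "trace_le I (cliques_word es) (cliques_word (es @ [c]))"
      by (simp add: trace_le_append)
    moreover have "trace_le I (cliques_word (es @ [c])) (cliques_word (map \<xi> [0..<length (es @ [c])]))"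
      using that assms up_cliques_word[of "es @ [c]"] by simp
    ultimately have "trace_le I (cliques_word es) (cliques_word (map \<xi> [0..<length (es @ [c])]))"
      by (rule trace_le_trans)
    then have "trace_le I (cliques_word es)
        (cliques_word (take (length es) (map \<xi> [0..<length (es @ [c])])))"
      using assms \<xi> by (intro trace_le_take normal_cliques_boundary)
    then show ?thesis
      using \<xi> assms by (simp add: up_cliques_word)
  qed
  with * show ?thesis by blast
qed

text \<open>If E is \<open>d\<close>, the normal form of the residual starts with \<open>d\<close>,
  so it can be appended to \<open>es\<close> without losing normality. Uniqueness identifies the
  result with the first k+1 cliques of \<xi>.\<close>

lemma cylinder_snoc:
  assumes "normal_cliques I (es @ [d])"
  shows "cylinder (es @ [d]) = {\<xi> \<in> up I (trace_of I (cliques_word es)). next_clique es \<xi> = d}"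
proof -
  have es: "set es \<subseteq> cliques I" and d: "d \<in> cliques I"
    using assms by (auto simp: normal_cliques_def)
  show ?thesis
  proof (intro subset_antisym subsetI)
    fix \<xi> assume "\<xi> \<in> cylinder (es @ [d])"
    then have \<xi>: "\<xi> \<in> boundary I" and m: "map \<xi> [0..<Suc (length es)] = es @ [d]"
      by (auto simp: cylinder_def)
    then have m': "map \<xi> [0..<length es] = es"
      by simp
    have up: "\<xi> \<in> up I (trace_of I (cliques_word es))"
      using \<xi> es by (simp add: up_cliques_word m' trace_le_refl del: map_map)
    moreover have "next_clique es \<xi> = d"
    proof -
      obtain z where z:
        "trace_eq I (cliques_word (map \<xi> [0..<Suc (length es)])) (cliques_word es @ z)"
        "next_clique es \<xi> = initials I z"
        using residual[OF es up] .
      have "trace_eq I (clique_word d) z"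
        using z(1) unfolding m by (simp add: trace_eq_append_cancel)
      then show ?thesis
        using z(2) d trace_eq_initials by (metis clique_word(2) initials_clique)
    qed
    ultimately show "\<xi> \<in> {\<xi> \<in> up I (trace_of I (cliques_word es)). next_clique es \<xi> = d}"
      by simp
  next
    fix \<xi> assume "\<xi> \<in> {\<xi> \<in> up I (trace_of I (cliques_word es)). next_clique es \<xi> = d}"
    then have up: "\<xi> \<in> up I (trace_of I (cliques_word es))" and nc: "next_clique es \<xi> = d"
      by auto
    then have \<xi>: "\<xi> \<in> boundary I"
      by (simp add: up_def)
    obtain z where z:
      "trace_eq I (cliques_word (map \<xi> [0..<Suc (length es)])) (cliques_word es @ z)"
      "next_clique es \<xi> = initials I z"
      using residual[OF es up] .
    obtain ds where ds: "normal_cliques I ds" "trace_eq I z (cliques_word ds)"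
      using normal_cliques_exists by blast
    have "initials I (cliques_word ds) = d" "d \<noteq> {}"
      using z nc trace_eq_initials[OF ds(2)] assms by (auto simp: normal_cliques_def)
    then obtain ds' where ds': "ds = d # ds'"
      using initials_normal_cliques ds(1) by (cases ds) auto
    have "normal_cliques I (es @ ds)"
      using assms ds(1) ds' by (auto simp: normal_cliques_def successively_append_iff)
    moreover have "trace_eq I (cliques_word (map \<xi> [0..<Suc (length es)])) (cliques_word (es @ ds))"
      using trace_eq.trans[OF z(1) trace_eq_append_left[OF ds(2)]] by simp
    ultimately have eq: "map \<xi> [0..<Suc (length es)] = es @ d # ds'"
      using normal_cliques_unique[OF normal_cliques_boundary[OF \<xi>]] ds' by metis
    \<comment> \<open>The left side has exactly k+1 entries, so nothing follows
      \<open>d\<close>.\<close>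
    then have "length ds' = 0"
      using arg_cong[OF eq, of length] by simp
    then show "\<xi> \<in> cylinder (es @ [d])"
      using \<xi> eq by (simp add: cylinder_def)
  qed
qed

text \<open>For the empty product E is the first clique of \<xi>. This is the source of h(1) =
  0.\<close>

lemma next_clique_Nil_nonempty:
  assumes "\<xi> \<in> boundary I"
  shows "next_clique [] \<xi> \<noteq> {}"
proof -
  have up: "\<xi> \<in> up I (trace_of I (cliques_word []))"
    by (subst up_cliques_word) (simp_all add: assms trace_le_refl)
  obtain z where z: "trace_eq I (cliques_word (map \<xi> [0..<Suc (length [])])) (cliques_word [] @ z)"
    "next_clique [] \<xi> = initials I z"
    by (rule residual[OF _ up]) simp_all
  have "initials I (clique_word (\<xi> 0)) = initials I z"
    using trace_eq_initials[OF z(1)] by simp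
  moreover have "\<xi> 0 \<in> cliques I" "\<xi> 0 \<noteq> {}"
    using assms by (auto simp: boundary_def)
  ultimately show ?thesis
    using z(2) by simp
qed

end

section \<open>Moebius inversion over cliques\<close>

text \<open>The orthogonality relation of the Boolean lattice: a proper interval has as many members
  of even as of odd size.\<close>

lemma sum_alternating_interval:
  fixes e d :: "'a set"
  assumes "finite d" "e \<subseteq> d"
  shows "(\<Sum>c | e \<subseteq> c \<and> c \<subseteq> d. (-1) ^ (card c - card e)) = (of_bool (e = d) :: real)"
proof (cases "e = d")
  case True
  then have "{c. e \<subseteq> c \<and> c \<subseteq> d} = {d}" by auto
  then show ?thesis using True by simp
next
  case False
  have "(\<Sum>c | e \<subseteq> c \<and> c \<subseteq> d. (-1) ^ (card c - card e)) =
      (\<Sum>c | e \<subseteq> c \<and> c \<subseteq> d. (-1) ^ card e * (-1) ^ card c :: real)"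
    \<comment> \<open>As \<open>card e\<close> is at most \<open>card c\<close>, the truncated
      difference has the parity of the sum.\<close>
    using assms by (intro sum.cong HOL.refl)
      (auto simp: neg_one_power_add_eq_neg_one_power_diff card_mono finite_subset
        simp flip: power_add simp: add.commute)
  also have "\<dots> = (-1) ^ card e * (\<Sum>c | e \<subseteq> c \<and> c \<subseteq> d. (-1) ^ card c)"
    by (simp add: sum_distrib_left)
  also have "(\<Sum>c | e \<subseteq> c \<and> c \<subseteq> d. (-1) ^ card c :: real) = 0"
  proof (rule sum_alternating_cancels)
    show "finite {c. e \<subseteq> c \<and> c \<subseteq> d}"
      using assms(1) by (auto intro: finite_subset[of _ "Pow d"])
    have "e \<subset> d"
      using assms(2) False by blast
    then show "card {c \<in> {c. e \<subseteq> c \<and> c \<subseteq> d}. even (card c)} =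
        card {c \<in> {c. e \<subseteq> c \<and> c \<subseteq> d}. odd (card c)}"
      using card_subsupersets_even_odd[OF assms(1), of e] by (simp add: conj_ac)
  qed
  finally show ?thesis using False by simp
qed

text \<open>Exchanging the sums leaves, for each \<open>d\<close>, an alternating sum over the
  cliques between \<open>e\<close> and \<open>d\<close>, which vanishes unless they
  coincide.\<close>

lemma moebius_inversion:
  assumes "finite (cliques I)" "e \<in> cliques I"
    and f: "\<And>c. c \<in> cliques I \<Longrightarrow> f c = (\<Sum>d\<in>{d \<in> cliques I. c \<subseteq> d}. p d)"
  shows "moebius_transform I f e = p e"
proof -
  let ?s = "\<lambda>c. (-1) ^ (card c - card e) :: real"
  have "moebius_transform I f e =
      (\<Sum>c\<in>{c \<in> cliques I. e \<subseteq> c}. \<Sum>d | d \<in> cliques I \<and> c \<subseteq> d. ?s c * p d)"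
    unfolding moebius_transform_def
  proof (rule sum.cong[OF HOL.refl])
    fix c assume "c \<in> {c \<in> cliques I. e \<subseteq> c}"
    then have "f c = (\<Sum>d\<in>{d \<in> cliques I. c \<subseteq> d}. p d)"
      by (intro f) simp
    then show "?s c * f c = (\<Sum>d | d \<in> cliques I \<and> c \<subseteq> d. ?s c * p d)"
      by (simp only: sum_distrib_left)
  qed
  also have "\<dots> = (\<Sum>d\<in>cliques I. \<Sum>c | c \<in> {c \<in> cliques I. e \<subseteq> c} \<and> c \<subseteq> d. ?s c * p d)"
    using assms(1) by (intro sum.swap_restrict) auto
  also have "\<dots> = (\<Sum>d\<in>cliques I. of_bool (e = d) * p d)"
  proof (intro sum.cong HOL.refl)
    fix d assume d: "d \<in> cliques I"
    \<comment> \<open>Subsets of a clique are cliques, so the index set is a full Boolean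
      interval.\<close>
    then have "{c. c \<in> {c \<in> cliques I. e \<subseteq> c} \<and> c \<subseteq> d} = {c. e \<subseteq> c \<and> c \<subseteq> d}"
      by (auto simp: cliques_def dest: finite_subset)
    then have "(\<Sum>c | c \<in> {c \<in> cliques I. e \<subseteq> c} \<and> c \<subseteq> d. ?s c * p d) =
        (\<Sum>c | e \<subseteq> c \<and> c \<subseteq> d. ?s c) * p d"
      by (simp only: sum_distrib_right)
    also have "(\<Sum>c | e \<subseteq> c \<and> c \<subseteq> d. ?s c) = of_bool (e = d)"
    proof (cases "e \<subseteq> d")
      case True
      then show ?thesis
        using d by (intro sum_alternating_interval) (simp_all add: cliques_def)
    next
      case False
      then have "{c. e \<subseteq> c \<and> c \<subseteq> d} = {}" "e \<noteq> d"
        by blast+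
      then show ?thesis
        by (simp only: sum.empty of_bool_eq simp_thms)
    qed
    finally show "(\<Sum>c | c \<in> {c \<in> cliques I. e \<subseteq> c} \<and> c \<subseteq> d. ?s c * p d) = of_bool (e = d) * p d" .
  qed
  also have "\<dots> = p e"
    using assms(1,2) by simp
  finally show ?thesis .
qed

lemma moebius_transform_cmult: "moebius_transform I (\<lambda>c. k * f c) e = k * moebius_transform I f e"
  by (simp add: moebius_transform_def sum_distrib_left algebra_simps)

section \<open>Probabilities of cylinders under a Markov measure\<close>

locale trace_markov = independence I
  for I :: "('a::finite) rel" +
  fixes act :: "('x::finite) \<Rightarrow> 'a list set \<Rightarrow> 'x"
    and P :: "'x \<Rightarrow> (nat \<Rightarrow> 'a set) measure"
  assumes right_action: "right_action I act"
    and markov: "markov_measure I act P"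
begin

text \<open>\<open>valuation\<close> and \<open>clique_law\<close> are the f and h of the
  theorem.\<close>

abbreviation valuation :: "'x \<Rightarrow> 'a list set \<Rightarrow> real" where
  "valuation \<equiv> \<lambda>\<alpha> x. measure (P \<alpha>) (up I x)"

abbreviation clique_law :: "'x \<Rightarrow> 'a set \<Rightarrow> real" where
  "clique_law \<equiv> \<lambda>\<alpha>. moebius_transform I (\<lambda>c. valuation \<alpha> (clique_trace I c))"

abbreviation cliques_trace :: "'a set list \<Rightarrow> 'a list set" where
  "cliques_trace cs \<equiv> trace_of I (cliques_word cs)"

lemma prob_space_P: "prob_space (P \<alpha>)"
  using markov by (simp add: markov_measure_def)

lemma sets_P: "sets (P \<alpha>) = sigma_sets (boundary I) (up I ` carrier (trace_monoid I))"
  using markov by (auto simp: markov_measure_def boundary_algebra_def up_def intro!: sets_measure_of)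

lemma space_P: "space (P \<alpha>) = boundary I"
proof -
  have "sets (P \<alpha>) = sets (boundary_algebra I)"
    using markov by (simp add: markov_measure_def)
  then have "space (P \<alpha>) = space (boundary_algebra I)"
    by (rule sets_eq_imp_space_eq)
  then show ?thesis
    by (simp add: boundary_algebra_def space_measure_of_conv)
qed

lemma up_in_sets [measurable]: "up I (trace_of I w) \<in> sets (P \<alpha>)"
  unfolding sets_P by (intro sigma_sets.Basic imageI) simp

lemma boundary_in_sets [measurable]: "boundary I \<in> sets (P \<alpha>)"
  using sets.top[of "P \<alpha>"] by (simp add: space_P)

lemma act_Nil: "act \<alpha> (trace_of I []) = \<alpha>"
  using right_action by (simp add: right_action_def one_trace_monoid)

lemma act_append: "act \<alpha> (trace_of I (u @ v)) = act (act \<alpha> (trace_of I u)) (trace_of I v)"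
  using right_action by (simp add: right_action_def mult_trace_of)

lemma valuation_append:
  "valuation \<alpha> (trace_of I (u @ v)) =
    valuation \<alpha> (trace_of I u) * valuation (act \<alpha> (trace_of I u)) (trace_of I v)"
  using markov trace_of_in_carrier[of I u] trace_of_in_carrier[of I v]
  unfolding markov_measure_def by (metis mult_trace_of)

lemma up_Nil: "up I (trace_of I []) = boundary I"
  using up_cliques_word[of "[]"] by (simp add: trace_le_refl)

lemma valuation_Nil: "valuation \<alpha> (trace_of I []) = 1"
  using prob_space.prob_space[OF prob_space_P, of \<alpha>] by (simp add: up_Nil space_P)

text \<open>E equals \<open>d\<close> when E contains \<open>d\<close> but no clique strictly above
  \<open>d\<close>: a finite Boolean combination of sets \<open>up\<close>.\<close>

lemma next_clique_event_in_sets: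
  assumes "set es \<subseteq> cliques I" "d \<in> cliques I"
  shows "{\<xi> \<in> up I (cliques_trace es). next_clique es \<xi> = d} \<in> sets (P \<alpha>)"
proof -
  let ?U = "\<lambda>c. up I (cliques_trace (es @ [c]))"
  have *: "?U c = {\<xi> \<in> up I (cliques_trace es). c \<subseteq> next_clique es \<xi>}" if "c \<in> cliques I" for c
    using up_cliques_word_snoc[OF assms(1) that] .
  have "{\<xi> \<in> up I (cliques_trace es). next_clique es \<xi> = d} =
      ?U d - (\<Union>c\<in>{c \<in> cliques I. d \<subset> c}. ?U c)"
    using assms next_clique_in_cliques[OF assms(1)] by (auto simp: * simp del: concat_append map_append)
  also have "\<dots> \<in> sets (P \<alpha>)"
    by (intro sets.Diff sets.finite_UN up_in_sets finite)
  finally show ?thesis .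
qed

text \<open>The set \<open>up\<close> of the product followed by \<open>c\<close> is the disjoint
  union of the events E = d over the cliques d above \<open>c\<close>; Moebius inversion recovers
  the probability of a single one.\<close>

lemma measure_next_clique:
  assumes "set es \<subseteq> cliques I" "d \<in> cliques I"
  shows "measure (P \<alpha>) {\<xi> \<in> up I (cliques_trace es). next_clique es \<xi> = d} =
    valuation \<alpha> (cliques_trace es) * clique_law (act \<alpha> (cliques_trace es)) d"
proof -
  interpret prob_space "P \<alpha>" by (rule prob_space_P)
  let ?E = "\<lambda>d. {\<xi> \<in> up I (cliques_trace es). next_clique es \<xi> = d}"
  have *: "prob (up I (cliques_trace (es @ [c]))) = (\<Sum>d\<in>{d \<in> cliques I. c \<subseteq> d}. prob (?E d))"
    if c: "c \<in> cliques I" for c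
  proof -
    have "up I (cliques_trace (es @ [c])) = (\<Union>d\<in>{d \<in> cliques I. c \<subseteq> d}. ?E d)"
      unfolding up_cliques_word_snoc[OF assms(1) c] using next_clique_in_cliques[OF assms(1)] by auto
    moreover have "prob (\<Union>d\<in>{d \<in> cliques I. c \<subseteq> d}. ?E d) =
        (\<Sum>d\<in>{d \<in> cliques I. c \<subseteq> d}. prob (?E d))"
      using next_clique_event_in_sets[OF assms(1)]
      by (intro finite_measure_finite_Union) (auto simp: disjoint_family_on_def)
    ultimately show ?thesis by (simp only:)
  qed
  have "moebius_transform I (\<lambda>c. prob (up I (cliques_trace (es @ [c])))) d = prob (?E d)"
    by (rule moebius_inversion[where p = "\<lambda>d. prob (?E d)", OF finite assms(2) *])
  \<comment> \<open>The Markov property splits off a factor independent of \<open>c\<close>; what is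
    left to transform is the valuation at the state reached.\<close>
  moreover have "prob (up I (cliques_trace (es @ [c]))) =
      valuation \<alpha> (cliques_trace es) * valuation (act \<alpha> (cliques_trace es)) (clique_trace I c)" for c
    using valuation_append[of \<alpha> "cliques_word es" "clique_word c"]
    by (simp add: clique_trace_clique_word)
  ultimately show ?thesis
    by (simp add: moebius_transform_cmult)
qed

lemma measure_cylinder:
  assumes "normal_cliques I (es @ [d])"
  shows "measure (P \<alpha>) (cylinder (es @ [d])) =
    valuation \<alpha> (cliques_trace es) * clique_law (act \<alpha> (cliques_trace es)) d"
  unfolding cylinder_snoc[OF assms] using assms
  by (intro measure_next_clique) (auto simp: normal_cliques_def)

lemma cylinder_normal:
  assumes "cylinder cs \<noteq> {}"
  shows "normal_cliques I cs"
proof -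
  obtain \<xi> where "\<xi> \<in> boundary I" "map \<xi> [0..<length cs] = cs"
    using assms by (auto simp: cylinder_def)
  then show ?thesis
    using normal_cliques_boundary by metis
qed

lemma cylinder_in_sets [measurable]: "cylinder cs \<in> sets (P \<alpha>)"
proof (cases "normal_cliques I cs")
  case True
  show ?thesis
  proof (cases cs rule: rev_cases)
    case Nil
    then show ?thesis by (simp add: cylinder_def)
  next
    case (snoc es d)
    then have "normal_cliques I (es @ [d])"
      using True by simp
    from cylinder_snoc[OF this] this show ?thesis
      using snoc by (simp add: next_clique_event_in_sets normal_cliques_def subset_iff)
  qed
next
  case False
  then have "cylinder cs = {}"
    using cylinder_normal by blast
  then show ?thesis by simp
qed

section \<open>Sign and normalization of the clique law\<close>

lemma measure_cylinder_single:
  assumes "\<gamma> \<in> nonempty_cliques I"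
  shows "measure (P \<alpha>) (cylinder [\<gamma>]) = clique_law \<alpha> \<gamma>"
  using measure_cylinder[of "[]" \<gamma> \<alpha>] assms
  by (simp add: normal_cliques_def valuation_Nil act_Nil)

lemma clique_law_nonneg: "\<gamma> \<in> nonempty_cliques I \<Longrightarrow> clique_law \<alpha> \<gamma> \<ge> 0"
  by (metis measure_cylinder_single measure_nonneg)

text \<open>For the empty product the event that E is empty has probability f(1) h(1) = h(1), and no
  boundary point belongs to it.\<close>

lemma clique_law_empty: "clique_law \<alpha> {} = 0"
proof -
  have empty: "{\<xi> \<in> up I (trace_of I []). next_clique [] \<xi> = {}} = {}"
    using next_clique_Nil_nonempty by (auto simp: up_def)
  have "{} \<in> cliques I"
    by (simp add: cliques_def)
  from measure_next_clique[OF _ this, of "[]" \<alpha>] show ?thesis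
    by (simp only: list.map concat.simps list.set empty_subsetI empty measure_empty
        valuation_Nil act_Nil mult_1 simp_thms)
qed

lemma moebius_fibred_valuation: "moebius_fibred_valuation I act valuation"
  using valuation_Nil valuation_append clique_law_empty clique_law_nonneg
  unfolding moebius_fibred_valuation_def fibred_valuation_def carrier_trace_monoid
  by (auto simp: one_trace_monoid mult_trace_of)

lemma normalization_factor_nonneg:
  "normalization_factor I clique_law \<alpha> \<gamma> \<ge> 0"
  unfolding normalization_factor_def by (intro sum_nonneg clique_law_nonneg) auto

text \<open>Splitting the event \<open>C\<^sub>1 = \<gamma>\<close> according to the value of \<open>C\<^sub>2\<close>.\<close>

lemma clique_law_eq_normalization_factor:
  assumes "\<gamma> \<in> nonempty_cliques I"
  shows "clique_law \<alpha> \<gamma> = valuation \<alpha> (clique_trace I \<gamma>) *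
    normalization_factor I clique_law (act \<alpha> (clique_trace I \<gamma>)) \<gamma>"
proof -
  interpret prob_space "P \<alpha>" by (rule prob_space_P)
  let ?N = "{\<gamma>' \<in> nonempty_cliques I. clique_arrow I \<gamma> \<gamma>'}"
  have "cylinder [\<gamma>] = (\<Union>\<gamma>'\<in>?N. cylinder [\<gamma>, \<gamma>'])"
    by (auto simp: cylinder_def boundary_def)
  then have "clique_law \<alpha> \<gamma> = prob (\<Union>\<gamma>'\<in>?N. cylinder [\<gamma>, \<gamma>'])"
    using measure_cylinder_single[OF assms, of \<alpha>] by simp
  also have "\<dots> = (\<Sum>\<gamma>'\<in>?N. prob (cylinder [\<gamma>, \<gamma>']))"
  proof (intro finite_measure_finite_Union)
    show "disjoint_family_on (\<lambda>\<gamma>'. cylinder [\<gamma>, \<gamma>']) ?N"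
      by (auto simp: disjoint_family_on_def cylinder_def)
  qed auto
  also have "\<dots> = (\<Sum>\<gamma>'\<in>?N. valuation \<alpha> (clique_trace I \<gamma>) *
      clique_law (act \<alpha> (clique_trace I \<gamma>)) \<gamma>')"
    using measure_cylinder[of "[\<gamma>]"] assms
    by (intro sum.cong HOL.refl) (simp add: normal_cliques_def clique_trace_clique_word)
  finally show ?thesis
    by (simp add: normalization_factor_def sum_distrib_left)
qed

section \<open>Paths of the chain and transition probabilities\<close>

text \<open>There are countably many lists of cliques, so it suffices that the fibres, which are
  cylinders or empty, are measurable.\<close>

lemma measurable_prefix: "(\<lambda>\<xi>. map \<xi> [0..<n]) \<in> measurable (P \<alpha>) (count_space UNIV)"
proof -
  have "(\<lambda>\<xi>. map \<xi> [0..<n]) -` {cs} \<inter> space (P \<alpha>) = (if length cs = n then cylinder cs else {})" for cs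
    by (auto simp: cylinder_def space_P)
  then show ?thesis
    by (simp add: measurable_count_space_eq2_countable)
qed

lemma measurable_state_clique:
  "state_clique I act \<alpha>\<^sub>0 n \<in> measurable (P \<alpha>) (count_space (UNIV \<times> nonempty_cliques I))"
proof -
  \<comment> \<open>State \<open>n\<close> pairs X_n, which depends on the first \<open>n\<close>
    cliques, with C_(n+1), which is entry \<open>n\<close>; hence the prefix of length
    \<open>Suc n\<close>.\<close>
  let ?g = "\<lambda>cs. (act \<alpha>\<^sub>0 (cliques_trace (take n cs)), cs ! n)"
  have "state_clique I act \<alpha>\<^sub>0 n = (\<lambda>\<xi>. ?g (map \<xi> [0..<Suc n]))"
    by (auto simp: state_clique_def boundary_prefix_eq fun_eq_iff take_map nth_append)
  also have "\<dots> \<in> measurable (P \<alpha>) (count_space UNIV)"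
    by (rule measurable_compose[OF measurable_prefix]) simp
  finally have "state_clique I act \<alpha>\<^sub>0 n \<in> measurable (P \<alpha>) (count_space UNIV)" .
  from measurable_sets[OF this] show ?thesis
    by (subst measurable_count_space_eq2)
      (auto simp: space_P state_clique_def boundary_def)
qed

text \<open>The cliques determine the X-components. A prescribed path is therefore either
  inconsistent or amounts to prescribing its first \<open>Suc n\<close> cliques.\<close>

lemma state_clique_event:
  "{\<xi> \<in> space (P \<alpha>). \<forall>i\<le>n. state_clique I act \<alpha>\<^sub>0 i \<xi> = s i} =
    (if \<forall>i\<le>n. fst (s i) = act \<alpha>\<^sub>0 (cliques_trace (map (snd \<circ> s) [0..<i]))
     then cylinder (map (snd \<circ> s) [0..<Suc n]) else {})"
proof -
  have "(\<forall>i\<le>n. state_clique I act \<alpha>\<^sub>0 i \<xi> = s i) \<longleftrightarrow>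
    (\<forall>i\<le>n. fst (s i) = act \<alpha>\<^sub>0 (cliques_trace (map (snd \<circ> s) [0..<i]))) \<and>
    map \<xi> [0..<Suc n] = map (snd \<circ> s) [0..<Suc n]" for \<xi>
  proof -
    have prefix: "map \<xi> [0..<Suc n] = map (snd \<circ> s) [0..<Suc n] \<longleftrightarrow> (\<forall>i\<le>n. \<xi> i = snd (s i))"
      unfolding map_eq_conv by auto
    have "boundary_prefix I \<xi> i = cliques_trace (map (snd \<circ> s) [0..<i])"
      if "\<forall>i\<le>n. \<xi> i = snd (s i)" "i \<le> n" for i
    proof -
      have "map \<xi> [0..<i] = map (snd \<circ> s) [0..<i]"
        using that unfolding map_eq_conv by auto
      then show ?thesis
        by (simp only: boundary_prefix_eq)
    qed
    then have "(\<forall>i\<le>n. act \<alpha>\<^sub>0 (boundary_prefix I \<xi> i) = fst (s i)) \<longleftrightarrow>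
        (\<forall>i\<le>n. fst (s i) = act \<alpha>\<^sub>0 (cliques_trace (map (snd \<circ> s) [0..<i])))"
      if "\<forall>i\<le>n. \<xi> i = snd (s i)"
      using that by force
    then show ?thesis
      unfolding state_clique_def prefix prod_eq_iff fst_conv snd_conv by blast
  qed
  then show ?thesis
    by (auto simp: space_P cylinder_def simp del: upt_Suc)
qed

lemma initial_law:
  assumes "\<gamma> \<in> nonempty_cliques I"
  shows "\<P>(\<xi> in P \<alpha>\<^sub>0. state_clique I act \<alpha>\<^sub>0 0 \<xi> = (\<alpha>, \<gamma>)) = of_bool (\<alpha> = \<alpha>\<^sub>0) * clique_law \<alpha>\<^sub>0 \<gamma>"
  using state_clique_event[of \<alpha>\<^sub>0 0 \<alpha>\<^sub>0 "\<lambda>_. (\<alpha>, \<gamma>)"] measure_cylinder_single[OF assms, of \<alpha>\<^sub>0]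
  by (simp add: act_Nil)

text \<open>With y the product of the cliques up to time \<open>n\<close>, the history has
  probability f(y) g and its extension f(y) h times the two indicators, so f(y) cancels. That g is
  nonzero after a possible history is recorded for the stochastic matrix of
  \<open>homogeneous_chain\<close>.\<close>

lemma conditional_transition:
  assumes s: "\<forall>i\<le>n. s i \<in> UNIV \<times> nonempty_cliques I" and t: "t \<in> UNIV \<times> nonempty_cliques I"
    and pos: "\<P>(\<xi> in P \<alpha>\<^sub>0. \<forall>i\<le>n. state_clique I act \<alpha>\<^sub>0 i \<xi> = s i) > 0"
  shows "normalization_factor I clique_law (act (fst (s n)) (clique_trace I (snd (s n)))) (snd (s n)) \<noteq> 0"
    and "\<P>(\<xi> in P \<alpha>\<^sub>0. state_clique I act \<alpha>\<^sub>0 (Suc n) \<xi> = t \<bar>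
      \<forall>i\<le>n. state_clique I act \<alpha>\<^sub>0 i \<xi> = s i) = transition_matrix I act clique_law (s n) t"
proof -
  define cs where "cs = (\<lambda>i. map (snd \<circ> s) [0..<i])"
  define \<gamma> where "\<gamma> = snd (s n)"
  define \<alpha>' where "\<alpha>' = act (fst (s n)) (clique_trace I \<gamma>)"
  let ?Z = "state_clique I act \<alpha>\<^sub>0"
  let ?E = "{\<xi> \<in> space (P \<alpha>\<^sub>0). \<forall>i\<le>n. ?Z i \<xi> = s i}"
  let ?g = "normalization_factor I clique_law \<alpha>' \<gamma>"
  \<comment> \<open>Positive probability makes the event nonempty, which forces the states to be
    those determined by the cliques and the cliques to be normal.\<close>
  have "?E \<noteq> {}"
    using pos by (metis less_irrefl measure_empty)
  then have states: "fst (s i) = act \<alpha>\<^sub>0 (cliques_trace (cs i))" if "i \<le> n" for i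
    using that unfolding state_clique_event cs_def by (auto split: if_splits)
  then have E: "?E = cylinder (cs (Suc n))"
    unfolding state_clique_event cs_def by (simp del: upt_Suc)
  have cs_Suc: "cs (Suc n) = cs n @ [\<gamma>]"
    by (simp add: cs_def \<gamma>_def)
  have \<alpha>': "\<alpha>' = act \<alpha>\<^sub>0 (cliques_trace (cs n @ [\<gamma>]))"
    using act_append[of \<alpha>\<^sub>0 "cliques_word (cs n)" "clique_word \<gamma>"]
    by (simp add: \<alpha>'_def states clique_trace_clique_word)
  have normal: "normal_cliques I (cs n @ [\<gamma>])"
    using \<open>?E \<noteq> {}\<close> cylinder_normal unfolding E cs_Suc by blast
  have \<gamma>: "\<gamma> \<in> nonempty_cliques I"
    using s[rule_format, of n] by (auto simp: \<gamma>_def)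
  have "measure (P \<alpha>\<^sub>0) ?E = valuation \<alpha>\<^sub>0 (cliques_trace (cs n)) * clique_law (fst (s n)) \<gamma>"
    unfolding E cs_Suc by (simp only: measure_cylinder[OF normal] states[OF order_refl])
  \<comment> \<open>Trading h for f times g produces the same factor f(y) that the extended history
    will have.\<close>
  also have "\<dots> = valuation \<alpha>\<^sub>0 (cliques_trace (cs n)) * (valuation (fst (s n)) (clique_trace I \<gamma>) * ?g)"
    using clique_law_eq_normalization_factor[OF \<gamma>, of "fst (s n)"] by (simp only: \<alpha>'_def)
  also have "\<dots> = valuation \<alpha>\<^sub>0 (cliques_trace (cs n @ [\<gamma>])) * ?g"
    using valuation_append[of \<alpha>\<^sub>0 "cliques_word (cs n)" "clique_word \<gamma>"]
    by (simp add: states clique_trace_clique_word)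
  finally have measE: "measure (P \<alpha>\<^sub>0) ?E = valuation \<alpha>\<^sub>0 (cliques_trace (cs n @ [\<gamma>])) * ?g" .
  then have nz: "valuation \<alpha>\<^sub>0 (cliques_trace (cs n @ [\<gamma>])) \<noteq> 0" "?g \<noteq> 0"
    using pos by auto
  then show "normalization_factor I clique_law (act (fst (s n)) (clique_trace I (snd (s n)))) (snd (s n)) \<noteq> 0"
    by (simp add: \<alpha>'_def \<gamma>_def)
  obtain \<beta> \<gamma>' where t_eq: "t = (\<beta>, \<gamma>')" and \<gamma>': "\<gamma>' \<in> nonempty_cliques I"
    using t by auto
  \<comment> \<open>The path prolonged by \<open>t\<close>, so that
    \<open>state_clique_event\<close> covers the numerator as well.\<close>
  define s' where "s' = s(Suc n := t)"
  have s': "s' i = s i" if "i \<le> n" for i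
    using that by (simp add: s'_def)
  have s'_Suc: "s' (Suc n) = (\<beta>, \<gamma>')"
    by (simp add: s'_def t_eq)
  have old: "map (snd \<circ> s') [0..<i] = cs i" if "i \<le> Suc n" for i
    using that unfolding cs_def map_eq_conv by (auto simp: s'_def)
  have new: "map (snd \<circ> s') [0..<Suc (Suc n)] = cs n @ [\<gamma>] @ [\<gamma>']"
    using old[of "Suc n"] by (simp add: s'_Suc cs_Suc)
  have "(\<forall>i\<le>Suc n. fst (s' i) = act \<alpha>\<^sub>0 (cliques_trace (map (snd \<circ> s') [0..<i]))) \<longleftrightarrow>
      (\<forall>i\<le>Suc n. fst (s' i) = act \<alpha>\<^sub>0 (cliques_trace (cs i)))"
    using old by simp
  \<comment> \<open>Consistency up to time \<open>n\<close> is known; only the condition at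
    \<open>Suc n\<close> remains.\<close>
  also have "\<dots> \<longleftrightarrow> \<beta> = \<alpha>'"
    using states s' s'_Suc \<alpha>' cs_Suc unfolding le_Suc_eq by force
  finally have "{\<xi> \<in> space (P \<alpha>\<^sub>0). \<forall>i\<le>Suc n. ?Z i \<xi> = s' i} =
      (if \<beta> = \<alpha>' then cylinder ((cs n @ [\<gamma>]) @ [\<gamma>']) else {})"
    unfolding state_clique_event new by simp
  moreover have "{\<xi> \<in> space (P \<alpha>\<^sub>0). \<forall>i\<le>Suc n. ?Z i \<xi> = s' i} =
      {\<xi> \<in> space (P \<alpha>\<^sub>0). ?Z (Suc n) \<xi> = t \<and> (\<forall>i\<le>n. ?Z i \<xi> = s i)}"
    using s' s'_Suc by (auto simp: le_Suc_eq t_eq)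
  moreover have "measure (P \<alpha>\<^sub>0) (cylinder ((cs n @ [\<gamma>]) @ [\<gamma>'])) =
      valuation \<alpha>\<^sub>0 (cliques_trace (cs n @ [\<gamma>])) * (of_bool (clique_arrow I \<gamma> \<gamma>') * clique_law \<alpha>' \<gamma>')"
  proof (cases "clique_arrow I \<gamma> \<gamma>'")
    case True
    then have "normal_cliques I ((cs n @ [\<gamma>]) @ [\<gamma>'])"
      using normal \<gamma>' by (auto simp: normal_cliques_def successively_append_iff)
    then show ?thesis
      using True by (simp only: measure_cylinder \<alpha>' of_bool_eq mult_1)
  next
    case False
    then have "\<not> normal_cliques I ((cs n @ [\<gamma>]) @ [\<gamma>'])"
      by (auto simp: normal_cliques_def successively_append_iff)
    then have "cylinder ((cs n @ [\<gamma>]) @ [\<gamma>']) = {}"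
      using cylinder_normal by blast
    then show ?thesis
      using False by simp
  qed
  ultimately have "\<P>(\<xi> in P \<alpha>\<^sub>0. ?Z (Suc n) \<xi> = t \<and> (\<forall>i\<le>n. ?Z i \<xi> = s i)) =
      valuation \<alpha>\<^sub>0 (cliques_trace (cs n @ [\<gamma>])) *
      (of_bool (\<beta> = \<alpha>') * of_bool (clique_arrow I \<gamma> \<gamma>') * clique_law \<alpha>' \<gamma>')"
    by simp
  then have "\<P>(\<xi> in P \<alpha>\<^sub>0. ?Z (Suc n) \<xi> = t \<bar> \<forall>i\<le>n. ?Z i \<xi> = s i) =
      of_bool (\<beta> = \<alpha>') * of_bool (clique_arrow I \<gamma> \<gamma>') * clique_law \<alpha>' \<gamma>' / ?g"
    using nz by (simp add: cond_prob_def measE)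
  moreover have "s n = (fst (s n), \<gamma>)"
    by (simp add: \<gamma>_def)
  then have "transition_matrix I act clique_law (s n) t =
      of_bool (\<beta> = \<alpha>') * of_bool (clique_arrow I \<gamma> \<gamma>') * (clique_law \<alpha>' \<gamma>' / ?g)"
    unfolding transition_matrix_def t_eq by (auto simp: \<alpha>'_def split: prod.split)
  ultimately show "\<P>(\<xi> in P \<alpha>\<^sub>0. ?Z (Suc n) \<xi> = t \<bar> \<forall>i\<le>n. ?Z i \<xi> = s i) =
      transition_matrix I act clique_law (s n) t"
    by simp
qed

section \<open>The Markov chain and its stochastic matrix\<close>

text \<open>One matrix serves all starting states, since \<open>\<alpha>\<^sub>0\<close> does not
  occur in it.\<close>

lemma chain_with_transition_matrix:
  "chain_with_transitions (P \<alpha>\<^sub>0) (UNIV \<times> nonempty_cliques I) (state_clique I act \<alpha>\<^sub>0)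
    (transition_matrix I act clique_law)"
  unfolding chain_with_transitions_def
  using measurable_state_clique conditional_transition(2) by blast

text \<open>The indicators leave one state and the cliques that may follow \<gamma>, so the row sums
  to g / g.\<close>

lemma transition_matrix_row_sum:
  assumes "normalization_factor I clique_law (act \<alpha> (clique_trace I \<gamma>)) \<gamma> \<noteq> 0"
  shows "(\<Sum>t\<in>UNIV \<times> nonempty_cliques I. transition_matrix I act clique_law (\<alpha>, \<gamma>) t) = 1"
proof -
  let ?\<alpha>' = "act \<alpha> (clique_trace I \<gamma>)"
  let ?g = "normalization_factor I clique_law ?\<alpha>' \<gamma>"
  have "(\<Sum>t\<in>UNIV \<times> nonempty_cliques I. transition_matrix I act clique_law (\<alpha>, \<gamma>) t) =
      (\<Sum>\<beta>\<in>UNIV. \<Sum>\<gamma>'\<in>nonempty_cliques I. of_bool (\<beta> = ?\<alpha>') *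
        (of_bool (clique_arrow I \<gamma> \<gamma>') * (clique_law ?\<alpha>' \<gamma>' / ?g)))"
    unfolding sum.cartesian_product
    by (intro sum.cong HOL.refl) (auto simp: transition_matrix_def of_bool_def split: if_splits)
  also have "\<dots> = (\<Sum>\<beta>\<in>UNIV. of_bool (\<beta> = ?\<alpha>') *
      ((\<Sum>\<gamma>'\<in>nonempty_cliques I. of_bool (clique_arrow I \<gamma> \<gamma>') * clique_law ?\<alpha>' \<gamma>') / ?g))"
    by (simp only: sum_divide_distrib sum_distrib_left times_divide_eq_right)
  also have "\<dots> = (\<Sum>\<gamma>'\<in>nonempty_cliques I. of_bool (clique_arrow I \<gamma> \<gamma>') * clique_law ?\<alpha>' \<gamma>') / ?g"
    by (simp del: times_divide_eq_right)
  also have "(\<Sum>\<gamma>'\<in>nonempty_cliques I. of_bool (clique_arrow I \<gamma> \<gamma>') * clique_law ?\<alpha>' \<gamma>') = ?g"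
    unfolding normalization_factor_def by (rule sum.mono_neutral_cong_right) auto
  finally show ?thesis
    using assms by simp
qed

text \<open>Where \<open>g\<close> vanishes the row of the transition matrix is zero; such states are almost surely
  never visited, so replacing the row by a Dirac mass yields a stochastic matrix.\<close>

lemma homogeneous_chain:
  "homogeneous_markov_chain (P \<alpha>\<^sub>0) (UNIV \<times> nonempty_cliques I) (state_clique I act \<alpha>\<^sub>0)"
proof -
  let ?S = "UNIV \<times> nonempty_cliques I :: ('x \<times> 'a set) set"
  let ?g = "\<lambda>s. normalization_factor I clique_law (act (fst s) (clique_trace I (snd s))) (snd s)"
  define Q where "Q = (\<lambda>s t. if ?g s = 0 then of_bool (t = s) else transition_matrix I act clique_law s t)"
  have "Q s t \<ge> 0" if "t \<in> ?S" for s t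
  proof -
    have "clique_law \<alpha> (snd t) \<ge> 0" for \<alpha>
      using that by (intro clique_law_nonneg) auto
    then show ?thesis
      by (simp add: Q_def transition_matrix_def normalization_factor_nonneg split_beta)
  qed
  moreover have "(Q s has_sum 1) ?S" if "s \<in> ?S" for s
  proof -
    have "(\<Sum>t\<in>?S. Q s t) = 1"
    proof (cases "?g s = 0")
      case True
      then show ?thesis
        using that by (simp add: Q_def)
    next
      case False
      then show ?thesis
        using transition_matrix_row_sum[of "fst s" "snd s"] by (simp add: Q_def)
    qed
    then show ?thesis
      using has_sum_finite[of ?S "Q s"] by simp
  qed
  moreover have "chain_with_transitions (P \<alpha>\<^sub>0) ?S (state_clique I act \<alpha>\<^sub>0) Q"
    unfolding chain_with_transitions_def
  proof (intro conjI allI impI)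
    show "state_clique I act \<alpha>\<^sub>0 n \<in> measurable (P \<alpha>\<^sub>0) (count_space ?S)" for n
      by (rule measurable_state_clique)
    fix n s t
    assume "\<forall>i\<le>n. s i \<in> ?S" "t \<in> ?S"
      and "\<P>(\<xi> in P \<alpha>\<^sub>0. \<forall>i\<le>n. state_clique I act \<alpha>\<^sub>0 i \<xi> = s i) > 0"
    note conditional_transition[OF this]
    then show "\<P>(\<xi> in P \<alpha>\<^sub>0. state_clique I act \<alpha>\<^sub>0 (Suc n) \<xi> = t \<bar>
        \<forall>i\<le>n. state_clique I act \<alpha>\<^sub>0 i \<xi> = s i) = Q (s n) t"
      by (simp add: Q_def)
  qed
  ultimately show ?thesis
    unfolding homogeneous_markov_chain_def by blast
qed

end

theorem theorem1:
  fixes I :: "('a::finite) rel"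
    and act :: "('x::finite) \<Rightarrow> 'a list set \<Rightarrow> 'x"
    and P :: "'x \<Rightarrow> (nat \<Rightarrow> 'a set) measure"
    and f :: "'x \<Rightarrow> 'a list set \<Rightarrow> real"
    and h :: "'x \<Rightarrow> 'a set \<Rightarrow> real"
  assumes "CARD('a) \<ge> 2"
    and "irrefl I" and "sym I"
    and "right_action I act"
    and "markov_measure I act P"
  defines "f \<equiv> \<lambda>\<alpha> x. measure (P \<alpha>) (up I x)"
    and "h \<equiv> \<lambda>\<alpha>. moebius_transform I (\<lambda>c. f \<alpha> (clique_trace I c))"
  shows "moebius_fibred_valuation I act f \<and>
    (\<forall>\<alpha>\<^sub>0.
       homogeneous_markov_chain (P \<alpha>\<^sub>0) (UNIV \<times> nonempty_cliques I) (state_clique I act \<alpha>\<^sub>0) \<and>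
       (\<forall>\<alpha>. \<forall>\<gamma>\<in>nonempty_cliques I.
          \<P>(\<xi> in P \<alpha>\<^sub>0. state_clique I act \<alpha>\<^sub>0 0 \<xi> = (\<alpha>, \<gamma>)) = of_bool (\<alpha> = \<alpha>\<^sub>0) * h \<alpha>\<^sub>0 \<gamma>) \<and>
       chain_with_transitions (P \<alpha>\<^sub>0) (UNIV \<times> nonempty_cliques I) (state_clique I act \<alpha>\<^sub>0)
         (transition_matrix I act h)) \<and>
    (\<forall>\<alpha>. \<forall>\<gamma>\<in>nonempty_cliques I. normalization_factor I h \<alpha> \<gamma> \<ge> 0)"
proof -
  interpret trace_markov I act P
    using assms(2-5) by unfold_locales
  show ?thesis
    unfolding h_def f_def
    using moebius_fibred_valuation homogeneous_chain initial_law chain_with_transition_matrix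
      normalization_factor_nonneg
    by blast
qed

end
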